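(* Let $(T,d)$ be a metric space, $m$ a Borel probability measure on $T$ with $\operatorname{supp}(m)=T$, and $\varphi:\mathbb{R}_+\to\mathbb{R}$ a Young function. Then there exists a probability measure $\nu$ on $T\times T$ such that for all continuous functions $f:T\to\mathbb{R}$, $$\sup_{s,t\in T}|f(s)-f(t)|\le 32\,\mathcal{S}\left(\frac23+\frac13\int_{T\times T}\varphi\left(\frac{|f(u)-f(v)|}{d(u,v)}\right)\nu(du,dv)\right).$$
   Context: $B(x,\varepsilon)=\{y\in T:d(x,y)\le\varepsilon\}$ is the closed ball and $D(T)=\sup\{d(s,t):s,t\in T\}$ the diameter of $T$ (possibly $+\infty$). A Young function is a (strictly) increasing convex function $\varphi:\mathbb{R}_+\to\mathbb{R}$ with $\varphi(0)=0$; $\varphi^{-1}$ is its inverse. Define $\mathcal{S}=\sup_{x\in T}\int_0^{D(T)}\varphi^{-1}\left(\frac{1}{m(B(x,\varepsilon))}\right)d\varepsilon\in[0,\infty]$. The convention $0/0=0$ is used (so the integrand equals $\varphi(0)=0$ on the diagonal $u=v$). *)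

theory Defs
  imports "HOL-Probability.Probability"
begin

definition measure_support :: "'a::topological_space measure \<Rightarrow> 'a set" where
  "measure_support M = {x. \<forall>U. open U \<longrightarrow> x \<in> U \<longrightarrow> emeasure M U > 0}"

(* Only the values on {0..} matter. *)
definition young_function :: "(real \<Rightarrow> real) \<Rightarrow> bool" where
  "young_function \<phi> \<longleftrightarrow> strict_mono_on {0..} \<phi> \<and> convex_on {0..} \<phi> \<and> \<phi> 0 = 0"

(* The library's diameter is real-valued and has no meaningful value on unbounded sets. *)
definition ediameter :: "'a::metric_space set \<Rightarrow> ennreal" where
  "ediameter A = (SUP s\<in>A. SUP t\<in>A. ennreal (dist s t))"

(* When m has full support, the denominator is positive for every \<epsilon> > 0.  A Young function maps
   {0..} onto {0..}, so inv_into is a genuine inverse at the arguments used here. *)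
definition majorizing_sup :: "(real \<Rightarrow> real) \<Rightarrow> 'a::metric_space measure \<Rightarrow> ennreal" where
  "majorizing_sup \<phi> m =
     (SUP x. \<integral>\<^sup>+ \<epsilon> \<in> {\<epsilon>. 0 < \<epsilon> \<and> ennreal \<epsilon> < ediameter (UNIV :: 'a set)}.
        ennreal (inv_into {0..} \<phi> (1 / measure m (cball x \<epsilon>))) \<partial>lborel)"

end

theory Submission
  imports Defs
begin

text \<open>
  Put \<open>a\<^sub>k = 4\<^sup>k \<phi>\<inverse>(1)\<close> and let \<open>r\<^sub>k(x)\<close> be the least radius with
  \<open>m(B(x, r\<^sub>k(x))) \<ge> 1 / \<phi>(a\<^sub>k)\<close>; these radii are 1-Lipschitz in \<open>x\<close>, and
  \<open>\<Sum>\<^sub>k a\<^sub>k r\<^sub>k(x)\<close> is at most \<open>4/3\<close> times the entropy integral at \<open>x\<close>.  Let \<open>S\<^sub>k f(x)\<close> be the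
  average of \<open>f\<close> over \<open>B(x, r\<^sub>k(x))\<close>, so that \<open>S\<^sub>0 f\<close> is the mean of \<open>f\<close> and \<open>S\<^sub>k f \<rightarrow> f\<close>.
  Since \<open>q \<le> a + a \<phi>(q) / \<phi>(a)\<close>, the error \<open>\<bar>f - S\<^sub>k f\<bar>\<close> at \<open>u\<close> is at most \<open>a\<^sub>k\<^sub>+\<^sub>1 r\<^sub>k(u)\<close> plus
  \<open>a\<^sub>k\<^sub>+\<^sub>1 r\<^sub>k(u) / \<phi>(a\<^sub>k\<^sub>+\<^sub>1)\<close> times the average of \<open>\<phi>(\<bar>f(u) - f(v)\<bar> / d(u, v))\<close> over \<open>v\<close>.
  Averaging this over \<open>B(x, r\<^sub>k\<^sub>+\<^sub>1(x))\<close> costs a factor \<open>\<phi>(a\<^sub>k\<^sub>+\<^sub>1)\<close> against \<open>m\<close>, which cancels the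
  denominator; so the second parts sum up to an integral against a measure on pairs that does not
  depend on \<open>x\<close> or \<open>f\<close>, and \<open>\<nu>\<close> is its normalisation.  Lipschitz continuity of the radii controls the
  first parts.
\<close>

section \<open>Young functions: monotonicity, chords, and inversion on the half-line\<close>

lemma young_function_nonneg:
  assumes "young_function \<phi>" "0 \<le> x"
  shows "0 \<le> \<phi> x"
  using assms unfolding young_function_def
  by (metis atLeast_iff order_refl strict_mono_on_leD)

lemma young_function_mono:
  assumes "young_function \<phi>" "0 \<le> x" "x \<le> y"
  shows "\<phi> x \<le> \<phi> y"
  using assms unfolding young_function_def
  by (meson atLeast_iff order_trans strict_mono_on_leD)

lemma young_function_strict_mono:
  assumes "young_function \<phi>" "0 \<le> x" "x < y"
  shows "\<phi> x < \<phi> y"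
  using assms unfolding young_function_def
  by (auto simp: strict_mono_on_def)

lemma young_function_pos:
  assumes "young_function \<phi>" "0 < x"
  shows "0 < \<phi> x"
  using young_function_strict_mono[OF assms(1), of 0 x] assms
  by (simp add: young_function_def)

lemma young_function_chord:
  assumes "young_function \<phi>" "0 \<le> x" "x \<le> a" "0 < a"
  shows "\<phi> x \<le> x / a * \<phi> a"
proof -
  have "\<phi> ((1 - x / a) *\<^sub>R 0 + (x / a) *\<^sub>R a) \<le> (1 - x / a) * \<phi> 0 + (x / a) * \<phi> a"
    using assms unfolding young_function_def
    by (intro convex_onD) auto
  then show ?thesis
    using assms by (simp add: young_function_def)
qed

text \<open>Either \<open>x \<le> a\<close>, or the chord from \<open>0\<close> to \<open>x\<close>
  shows that \<open>\<phi> t / t\<close> at \<open>a\<close> is at most its value at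
  \<open>x\<close>. This is the only way in which convexity enters the chaining: it turns a slope
  into a constant plus a multiple of its image under \<open>\<phi>\<close>.\<close>

lemma young_function_le_add:
  assumes "young_function \<phi>" "0 \<le> x" "0 < a"
  shows "x \<le> a + a / \<phi> a * \<phi> x"
proof (cases "x \<le> a")
  case True
  have "0 \<le> a / \<phi> a * \<phi> x"
    using assms young_function_nonneg[OF assms(1)] by simp
  then show ?thesis using True by linarith
next
  case False
  then have "\<phi> a \<le> a / x * \<phi> x"
    using assms by (intro young_function_chord) auto
  then have "x * \<phi> a \<le> a * \<phi> x"
    using False assms by (simp add: field_simps)
  then have "x \<le> a / \<phi> a * \<phi> x"
    using young_function_pos[OF assms(1,3)] by (simp add: field_simps)
  then show ?thesis using assms by linarith
qed

text \<open>Convexity gives continuity only on the open half-line, so the intermediate value theorem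
  is applied between two positive points. The chord bound on either side of \<open>1\<close>
  supplies them: \<open>d \<le> 1\<close> with \<open>\<phi> d \<le> y\<close> and
  \<open>e \<ge> 1\<close> with \<open>y \<le> \<phi> e\<close>.\<close>

lemma young_function_surj:
  assumes "young_function \<phi>" "0 \<le> y"
  shows "y \<in> \<phi> ` {0..}"
proof (cases "y = 0")
  case True
  then show ?thesis using assms by (auto simp: young_function_def intro!: image_eqI[of _ _ 0])
next
  case False
  have pos: "0 < \<phi> 1" using young_function_pos[OF assms(1)] by simp
  define d where "d = min 1 (y / \<phi> 1)"
  define e where "e = max 1 (y / \<phi> 1)"
  have d: "0 < d" "d \<le> 1" "d \<le> y / \<phi> 1" and e: "1 \<le> e" "y / \<phi> 1 \<le> e"
    using False assms pos by (auto simp: d_def e_def)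
  have "\<phi> d \<le> d / 1 * \<phi> 1" using d assms by (intro young_function_chord) auto
  also have "\<dots> \<le> y" using d pos by (simp add: field_simps)
  finally have 1: "\<phi> d \<le> y" .
  have "\<phi> 1 \<le> 1 / e * \<phi> e" using e assms by (intro young_function_chord) auto
  then have "e * \<phi> 1 \<le> \<phi> e" using e by (simp add: field_simps)
  moreover have "y \<le> e * \<phi> 1" using e pos by (simp add: field_simps)
  ultimately have 2: "y \<le> \<phi> e" by linarith
  have "convex_on {0<..} \<phi>"
    using assms by (auto simp: young_function_def intro: convex_on_subset)
  then have "continuous_on {0<..} \<phi>" by (intro convex_on_continuous) auto
  then have "continuous_on {d..e} \<phi>" by (rule continuous_on_subset) (use d in auto)
  then obtain x where "d \<le> x" "x \<le> e" "\<phi> x = y"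
    using IVT'[of \<phi> d y e] 1 2 d e by auto
  then show ?thesis using d by (intro image_eqI[of _ _ x]) auto
qed

lemma young_function_inv_into:
  assumes "young_function \<phi>" "0 \<le> y"
  shows "0 \<le> inv_into {0..} \<phi> y" "\<phi> (inv_into {0..} \<phi> y) = y"
  using inv_into_into[OF young_function_surj[OF assms]] f_inv_into_f[OF young_function_surj[OF assms]]
  by auto

lemma young_function_less_inv_into:
  assumes "young_function \<phi>" "\<phi> a < y" "0 \<le> y"
  shows "a < inv_into {0..} \<phi> y"
  using young_function_inv_into[OF assms(1,3)] assms(2) young_function_mono[OF assms(1)]
  by (metis linorder_not_le)

lemma young_function_le_inv_into:
  assumes "young_function \<phi>" "\<phi> a \<le> y" "0 \<le> y"
  shows "a \<le> inv_into {0..} \<phi> y"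
  using young_function_inv_into[OF assms(1,3)] assms(2) young_function_strict_mono[OF assms(1)]
  by (metis linorder_not_le)

text \<open>Nothing is known about \<open>\<phi>\<close> on negative arguments; composing with
  \<open>max 0\<close> gives a function that is monotone on all reals, hence Borel.\<close>

lemma measurable_young_function:
  assumes "young_function \<phi>"
  shows "(\<lambda>x. \<phi> (max 0 x)) \<in> borel_measurable borel"
  using young_function_mono[OF assms] by (intro borel_measurable_mono monoI) auto

section \<open>Auxiliary facts on diameters, lengths and geometric sums\<close>

lemma dist_le_ediameter:
  fixes x y :: "'a::metric_space"
  shows "ennreal (dist x y) \<le> ediameter (UNIV :: 'a set)"
  unfolding ediameter_def by (intro SUP_upper2[of x] SUP_upper2[of y]) auto

lemma ennreal_4_3: "4 / 3 = ennreal (4/3)"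
  by (metis divide_ennreal ennreal_numeral zero_le_numeral zero_less_numeral)

lemma emeasure_lborel_greaterThan: "emeasure lborel {a::real<..} = \<infinity>"
proof (rule ccontr)
  assume "emeasure lborel {a<..} \<noteq> \<infinity>"
  then obtain r where r: "emeasure lborel {a<..} = ennreal r" "0 \<le> r"
    by (cases "emeasure lborel {a<..}") auto
  have "ennreal (r + 1) = emeasure lborel {a<..<a + (r + 1)}"
    using r by simp
  also have "\<dots> \<le> emeasure lborel {a<..}"
    by (intro emeasure_mono) auto
  finally show False using r by (simp add: ennreal_le_iff)
qed

text \<open>If the last term is below \<open>y\<close>, the full geometric sum is
  \<open>c * 4 ^ n - c / 4\<close>, already less than \<open>y\<close>; otherwise the last term
  vanishes and induction applies. The factor \<open>3/4\<close> is the source of the later constant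
  \<open>4/3\<close>.\<close>

lemma sum_geometric_below:
  fixes c y :: real
  assumes "0 \<le> c" "0 \<le> y"
  shows "(\<Sum>k<n. 3/4 * (c * 4 ^ k) * of_bool (c * 4 ^ k < y)) \<le> y"
proof (induction n)
  case (Suc n)
  show ?case
  proof (cases "c * 4 ^ n < y")
    case True
    have "(\<Sum>k<Suc n. 3/4 * (c * 4 ^ k) * of_bool (c * 4 ^ k < y)) \<le> (\<Sum>k<Suc n. 3/4 * (c * 4 ^ k))"
      using assms by (intro sum_mono) (auto simp: of_bool_def)
    also have "\<dots> = 3/4 * c * (\<Sum>k<Suc n. 4 ^ k)"
      by (simp add: sum_distrib_left mult.assoc del: sum.lessThan_Suc)
    also have "\<dots> = c * 4 ^ n - c / 4"
      by (subst geometric_sum) (auto simp: field_simps)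
    also have "\<dots> \<le> y" using True assms by linarith
    finally show ?thesis .
  qed (use Suc in simp)
qed (use assms in simp)

section \<open>Countable bases and the Borel sets of a product\<close>

lemma countable_dense_imp_basis:
  fixes C :: "'a::metric_space set"
  assumes "countable C" and dense: "\<And>x e. 0 < e \<Longrightarrow> \<exists>c\<in>C. dist x c < e"
  shows "\<exists>B :: 'a set set. countable B \<and> topological_basis B"
proof (intro exI conjI)
  let ?B = "(\<lambda>(c, n). ball c (1 / real (Suc n))) ` (C \<times> UNIV)"
  show "countable ?B" using assms(1) by auto
  show "topological_basis ?B"
  proof (rule topological_basisI)
    fix U and x :: 'a assume "open U" "x \<in> U"
    then obtain e where e: "0 < e" "ball x e \<subseteq> U" by (meson openE)
    obtain n where n: "1 / real (Suc n) < e / 2"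
      using reals_Archimedean[of "e / 2"] e by (auto simp: inverse_eq_divide)
    obtain c where c: "c \<in> C" "dist x c < 1 / real (Suc n)"
      using dense[of "1 / real (Suc n)" x] by auto
    have "ball c (1 / real (Suc n)) \<subseteq> ball x e"
    proof
      fix y assume "y \<in> ball c (1 / real (Suc n))"
      then show "y \<in> ball x e"
        using dist_triangle[of x y c] c n unfolding mem_ball by linarith
    qed
    with e c show "\<exists>V\<in>?B. x \<in> V \<and> V \<subseteq> U"
      by (intro bexI[of _ "ball c (1 / real (Suc n))"]) (auto simp: dist_commute)
  qed auto
qed

text \<open>Products of basis sets form a countable basis of the product topology, so the rectangles
  generate all its Borel sets. The converse inclusion follows from continuity of the two
  projections.\<close>

lemma sets_borel_pair_basis:
  fixes B :: "'a::topological_space set set"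
  assumes "countable B" "topological_basis B"
  shows "sets (borel \<Otimes>\<^sub>M borel) = sets (borel :: ('a \<times> 'a) measure)"
proof
  let ?P = "(\<lambda>(b, c). b \<times> c) ` (B \<times> B)"
  have "sets (borel :: ('a \<times> 'a) measure) = sets (sigma UNIV ?P)"
    using assms by (intro arg_cong[where f=sets] borel_eq_countable_basis topological_basis_prod) auto
  also have "\<dots> = sigma_sets UNIV ?P"
    by (simp add: sets_measure_of_conv)
  also have "\<dots> \<subseteq> sets (borel \<Otimes>\<^sub>M borel)"
    using topological_basis_open[OF assms(2)] sets.top[of "borel \<Otimes>\<^sub>M borel :: ('a \<times> 'a) measure"]
    by (intro sets.sigma_sets_subset') (auto simp: space_pair_measure)
  finally show "sets (borel :: ('a \<times> 'a) measure) \<subseteq> sets (borel \<Otimes>\<^sub>M borel)" .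
  have "A \<times> C \<in> sets borel" if "A \<in> sets borel" "C \<in> sets borel" for A C :: "'a set"
  proof -
    have "fst -` A \<inter> space borel \<in> sets (borel :: ('a \<times> 'a) measure)"
      using that by (intro measurable_sets[OF borel_measurable_continuous_onI]) (auto intro: continuous_intros)
    moreover have "snd -` C \<inter> space borel \<in> sets (borel :: ('a \<times> 'a) measure)"
      using that by (intro measurable_sets[OF borel_measurable_continuous_onI]) (auto intro: continuous_intros)
    moreover have "A \<times> C = (fst -` A \<inter> space borel) \<inter> (snd -` C \<inter> space borel)"
      by auto
    ultimately show ?thesis by (metis sets.Int)
  qed
  then show "sets (borel \<Otimes>\<^sub>M borel) \<subseteq> sets (borel :: ('a \<times> 'a) measure)"
    unfolding sets_pair_measure by (intro sets.sigma_sets_subset') auto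
qed

section \<open>The nontrivial case of a finite entropy supremum\<close>

locale majorizing_space = prob_space m
  for m :: "'a::metric_space measure" +
  fixes \<phi> :: "real \<Rightarrow> real"
  assumes sets_m [measurable_cong, simp]: "sets m = sets borel"
    and support_m: "measure_support m = UNIV"
    and young: "young_function \<phi>"
    and majorizing: "majorizing_sup \<phi> m < \<infinity>"
begin

lemma space_m [simp]: "space m = UNIV"
  using sets_eq_imp_space_eq[OF sets_m] by simp

definition energy :: "'a \<Rightarrow> ennreal" where
  "energy x = (\<integral>\<^sup>+ \<epsilon> \<in> {\<epsilon>. 0 < \<epsilon> \<and> ennreal \<epsilon> < ediameter (UNIV :: 'a set)}.
        ennreal (inv_into {0..} \<phi> (1 / measure m (cball x \<epsilon>))) \<partial>lborel)"

lemma energy_le: "energy x \<le> majorizing_sup \<phi> m"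
  unfolding energy_def majorizing_sup_def by (rule SUP_upper) simp

lemma measure_cball_pos:
  assumes "0 < \<epsilon>"
  shows "0 < measure m (cball x \<epsilon>)"
proof -
  have "0 < emeasure m (ball x \<epsilon>)"
    using support_m assms unfolding measure_support_def
    by (metis (mono_tags, lifting) UNIV_I centre_in_ball mem_Collect_eq open_ball)
  also have "\<dots> \<le> emeasure m (cball x \<epsilon>)"
    by (intro emeasure_mono) auto
  finally show ?thesis
    by (simp add: emeasure_eq_measure)
qed

text \<open>The complement is an open null set, and full support leaves no point in it.\<close>

lemma closed_full_measure:
  assumes "closed A" "1 \<le> measure m A"
  shows "A = UNIV"
proof -
  have "measure m (UNIV - A) = 1 - measure m A"
    using prob_compl[of A] assms by simp
  then have "emeasure m (- A) = 0"
    using assms prob_le_1[of A] by (simp add: emeasure_eq_measure Compl_eq_Diff_UNIV)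
  then have "x \<notin> - A" for x
    using support_m assms(1) unfolding measure_support_def
    by (metis (mono_tags, lifting) UNIV_I less_numeral_extra(3) mem_Collect_eq open_Compl)
  then show ?thesis by auto
qed

section \<open>Geometric levels and finiteness of the diameter\<close>

definition level :: "nat \<Rightarrow> real" where
  "level k = inv_into {0..} \<phi> 1 * 4 ^ k"

lemma phi_level_0: "\<phi> (level 0) = 1"
  using young_function_inv_into[OF young, of 1] by (simp add: level_def)

lemma level_pos: "0 < level k"
proof -
  have "inv_into {0..} \<phi> 1 \<noteq> 0"
    using phi_level_0 young by (auto simp: level_def young_function_def)
  then show ?thesis
    using young_function_inv_into(1)[OF young, of 1] by (simp add: level_def)
qed

text \<open>The ratio 4 is large enough that three times the sum of the levels \<open>1\<close> to
  \<open>l\<close> stays below level \<open>l + 1\<close>, which is what the Lipschitz bound for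
  \<open>drift\<close> requires.\<close>

lemma level_Suc: "level (Suc k) = 4 * level k"
  by (simp add: level_def)

lemma level_mono: "k \<le> l \<Longrightarrow> level k \<le> level l"
  using level_pos[of 0] by (auto simp: level_def intro!: mult_left_mono power_increasing)

lemma phi_level_ge_1: "1 \<le> \<phi> (level k)"
  using young_function_mono[OF young, of "level 0" "level k"] level_mono[of 0 k] level_pos[of 0]
  by (simp add: phi_level_0)

text \<open>Ball measures are at most 1, so the entropy integrand is at least
  \<open>level 0 > 0\<close> at every positive radius; over an infinite range its integral would
  diverge.\<close>

lemma ediameter_finite: "ediameter (UNIV :: 'a set) < \<infinity>"
proof (rule ccontr)
  assume "\<not> ?thesis"
  then have top: "ediameter (UNIV :: 'a set) = \<infinity>" by (simp add: not_less top.extremum_unique)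
  have "\<infinity> = (\<integral>\<^sup>+ \<epsilon>. ennreal (level 0) * indicator {0::real<..} \<epsilon> \<partial>lborel)"
    using level_pos[of 0] emeasure_lborel_greaterThan
    by (subst nn_integral_cmult_indicator) (auto simp: ennreal_mult_top)
  also have "\<dots> \<le> energy undefined"
    unfolding energy_def
  proof (intro nn_integral_mono)
    fix \<epsilon> :: real
    have "level 0 \<le> inv_into {0..} \<phi> (1 / measure m (cball undefined \<epsilon>))" if "0 < \<epsilon>"
      using young phi_level_0 measure_cball_pos[OF that]
      by (intro young_function_le_inv_into) (auto simp: field_simps)
    then show "ennreal (level 0) * indicator {0<..} \<epsilon> \<le>
      ennreal (inv_into {0..} \<phi> (1 / measure m (cball undefined \<epsilon>))) *
        indicator {\<epsilon>. 0 < \<epsilon> \<and> ennreal \<epsilon> < ediameter (UNIV :: 'a set)} \<epsilon>"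
      by (auto simp: indicator_def top intro!: ennreal_leI)
  qed
  also have "\<dots> \<le> majorizing_sup \<phi> m" by (rule energy_le)
  finally show False using majorizing by simp
qed

lemma dist_le_diam: "dist (x :: 'a) y \<le> enn2real (ediameter (UNIV :: 'a set))"
proof -
  have "ennreal (dist x y) \<le> ennreal (enn2real (ediameter (UNIV :: 'a set)))"
    using dist_le_ediameter[of x y] ediameter_finite by simp
  then show ?thesis by (simp add: ennreal_le_iff)
qed

section \<open>Critical radii and their comparison with the entropy integral\<close>

definition radius :: "nat \<Rightarrow> 'a \<Rightarrow> real" where
  "radius k x = Inf {\<epsilon>. 0 \<le> \<epsilon> \<and> 1 \<le> \<phi> (level k) * measure m (cball x \<epsilon>)}"

lemma radius_le:
  assumes "0 \<le> \<epsilon>" "1 \<le> \<phi> (level k) * measure m (cball x \<epsilon>)"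
  shows "radius k x \<le> \<epsilon>"
  unfolding radius_def using assms by (intro cInf_lower) auto

lemma radius_set_nonempty:
  "enn2real (ediameter (UNIV :: 'a set)) \<in> {\<epsilon>. 0 \<le> \<epsilon> \<and> 1 \<le> \<phi> (level k) * measure m (cball x \<epsilon>)}"
proof -
  have "cball x (enn2real (ediameter (UNIV :: 'a set))) = UNIV"
    using dist_le_diam by auto
  then show ?thesis using phi_level_ge_1[of k] prob_space by simp
qed

lemma radius_nonneg: "0 \<le> radius k x"
  unfolding radius_def using radius_set_nonempty[of k x] by (intro cInf_greatest) blast+

lemma radius_le_diam: "radius k x \<le> enn2real (ediameter (UNIV :: 'a set))"
  using radius_set_nonempty[of k x] by (intro radius_le) auto

text \<open>The infimum is attained: the closed balls with radii
  \<open>radius k x + 1 / (n + 1)\<close> satisfy the bound and decrease to the ball of radius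
  \<open>radius k x\<close>, so continuity of the measure from above applies.\<close>

lemma measure_cball_radius: "1 \<le> \<phi> (level k) * measure m (cball x (radius k x))"
proof -
  define A where "A n = cball x (radius k x + 1 / real (Suc n))" for n
  have "(\<lambda>n. measure m (A n)) \<longlonglongrightarrow> measure m (\<Inter>n. A n)"
    by (intro finite_Lim_measure_decseq)
       (auto simp: A_def decseq_def intro!: subset_cball add_left_mono divide_left_mono)
  moreover have "(\<Inter>n. A n) = cball x (radius k x)"
  proof (intro equalityI subsetI)
    fix y assume y: "y \<in> (\<Inter>n. A n)"
    have "dist x y \<le> radius k x + e" if "0 < e" for e
    proof -
      obtain n where "1 / real (Suc n) < e"
        using reals_Archimedean[OF \<open>0 < e\<close>] by (auto simp: inverse_eq_divide)
      moreover have "dist x y \<le> radius k x + 1 / real (Suc n)"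
        using y unfolding A_def by (meson INT_D UNIV_I mem_cball)
      ultimately show ?thesis by linarith
    qed
    then show "y \<in> cball x (radius k x)"
      using field_le_epsilon by auto
  qed (auto simp: A_def intro: add_increasing2)
  ultimately have "(\<lambda>n. \<phi> (level k) * measure m (A n)) \<longlonglongrightarrow> \<phi> (level k) * measure m (cball x (radius k x))"
    by (auto intro: tendsto_intros)
  moreover have "1 \<le> \<phi> (level k) * measure m (A n)" for n
  proof -
    have "radius k x < radius k x + 1 / real (Suc n)" by simp
    then obtain e where e: "0 \<le> e" "1 \<le> \<phi> (level k) * measure m (cball x e)" "e < radius k x + 1 / real (Suc n)"
      unfolding radius_def using radius_set_nonempty[of k x] cInf_lessD
      by (smt (verit) empty_iff mem_Collect_eq)
    have "measure m (cball x e) \<le> measure m (A n)"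
      unfolding A_def using e by (intro finite_measure_mono) auto
    then show ?thesis using e(2) phi_level_ge_1[of k]
      by (meson mult_left_mono order_trans zero_le_one)
  qed
  ultimately show ?thesis by (intro LIMSEQ_le_const) auto
qed

lemma measure_cball_radius_pos: "0 < measure m (cball x (radius k x))"
  using measure_cball_radius[of k x] phi_level_ge_1[of k]
  by (metis less_eq_real_def measure_nonneg mult_zero_right not_one_le_zero)

text \<open>At level 0 the threshold is full measure, because \<open>\<phi> (level 0) = 1\<close>.
  Hence the chain of averages starts at the mean over the whole space.\<close>

lemma cball_radius_0: "cball x (radius 0 x) = UNIV"
  using measure_cball_radius[of 0 x] by (intro closed_full_measure) (auto simp: phi_level_0)

text \<open>The ball about \<open>y\<close> with radius \<open>radius k x + dist x y\<close>
  contains the critical ball about \<open>x\<close>, so this radius is admissible at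
  \<open>y\<close>.\<close>

lemma radius_lipschitz: "radius k y \<le> radius k x + dist x y"
proof (rule radius_le)
  have "measure m (cball x (radius k x)) \<le> measure m (cball y (radius k x + dist x y))"
  proof (intro finite_measure_mono subsetI)
    fix z assume "z \<in> cball x (radius k x)"
    then show "z \<in> cball y (radius k x + dist x y)"
      using dist_triangle[of y z x] by (simp add: dist_commute)
  qed auto
  then show "1 \<le> \<phi> (level k) * measure m (cball y (radius k x + dist x y))"
    using measure_cball_radius[of k x] phi_level_ge_1[of k]
    by (meson mult_left_mono order_trans zero_le_one)
qed (use radius_nonneg in auto)

lemma continuous_on_radius: "continuous_on UNIV (radius k)"
  unfolding continuous_on_iff
proof (intro ballI allI impI)
  fix x :: 'a and e :: real assume "0 < e"
  then show "\<exists>d>0. \<forall>x'\<in>UNIV. dist x' x < d \<longrightarrow> dist (radius k x') (radius k x) < e"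
    using radius_lipschitz[of k] by (intro exI[of _ e]) (smt (verit) dist_commute dist_real_def)
qed

text \<open>Each \<open>level k * radius k x\<close> is the integral of the constant
  \<open>level k\<close> over \<open>{0<..<radius k x}\<close>. If \<epsilon> lies below
  \<open>radius k x\<close>, minimality of the radius puts \<open>level k\<close> below the entropy
  integrand at \<epsilon>, so the sum over \<open>k\<close> is controlled pointwise by
  \<open>sum_geometric_below\<close>.\<close>

lemma sum_level_radius_le_energy:
  "(\<Sum>k<n. ennreal (level k * radius k x)) \<le> 4 / 3 * energy x"
proof -
  have "ennreal (3/4) * (\<Sum>k<n. ennreal (level k * radius k x)) =
      (\<Sum>k<n. \<integral>\<^sup>+\<epsilon>. ennreal (3/4 * level k) * indicator {0<..<radius k x} \<epsilon> \<partial>lborel)"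
    using level_pos radius_nonneg
    unfolding sum_distrib_left
    by (intro sum.cong)
       (simp_all add: nn_integral_cmult_indicator ennreal_mult[symmetric] less_imp_le mult.assoc)
  also have "\<dots> = (\<integral>\<^sup>+\<epsilon>. (\<Sum>k<n. ennreal (3/4 * level k) * indicator {0<..<radius k x} \<epsilon>) \<partial>lborel)"
    by (subst nn_integral_sum) auto
  also have "\<dots> \<le> energy x"
    unfolding energy_def
  proof (intro nn_integral_mono)
    fix \<epsilon> :: real
    define y where "y = inv_into {0..} \<phi> (1 / measure m (cball x \<epsilon>))"
    show "(\<Sum>k<n. ennreal (3/4 * level k) * indicator {0<..<radius k x} \<epsilon>)
      \<le> ennreal y * indicator {\<epsilon>. 0 < \<epsilon> \<and> ennreal \<epsilon> < ediameter (UNIV :: 'a set)} \<epsilon>"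
    proof (cases "0 < \<epsilon> \<and> ennreal \<epsilon> < ediameter (UNIV :: 'a set)")
      case True
      have *: "level k < y" if "\<epsilon> < radius k x" for k
      proof -
        have "\<phi> (level k) * measure m (cball x \<epsilon>) < 1"
          using radius_le[of \<epsilon> k x] that True by force
        then show ?thesis
          unfolding y_def using young True measure_cball_pos[of \<epsilon> x]
          by (intro young_function_less_inv_into) (auto simp: field_simps)
      qed
      have y: "0 \<le> y" unfolding y_def using young by (intro young_function_inv_into) auto
      have "(\<Sum>k<n. ennreal (3/4 * level k) * indicator {0<..<radius k x} \<epsilon>)
         \<le> (\<Sum>k<n. ennreal (3/4 * level k * of_bool (level k < y)))"
        using * by (intro sum_mono) (auto simp: indicator_def)
      also have "\<dots> = ennreal (\<Sum>k<n. 3/4 * level k * of_bool (level k < y))"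
        using level_pos by (intro sum_ennreal) (simp add: less_imp_le)
      also have "\<dots> \<le> ennreal y"
        unfolding level_def using level_pos[of 0] y
        by (intro ennreal_leI sum_geometric_below) (auto simp: level_def)
      finally show ?thesis using True by simp
    next
      case False
      \<comment> \<open>Outside the range of integration on the right the left side vanishes too,
        since no critical radius exceeds the diameter.\<close>
      have "\<epsilon> \<notin> {0<..<radius k x}" for k
      proof
        assume a: "\<epsilon> \<in> {0<..<radius k x}"
        then have "\<epsilon> < enn2real (ediameter (UNIV :: 'a set))"
          using radius_le_diam[of k x] by auto
        then have "ennreal \<epsilon> < ennreal (enn2real (ediameter (UNIV :: 'a set)))"
          using a by (intro ennreal_lessI) auto
        also have "\<dots> = ediameter (UNIV :: 'a set)"
          using ediameter_finite by simp
        finally show False using False a by simp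
      qed
      then show ?thesis by simp
    qed
  qed
  finally have le: "ennreal (3/4) * (\<Sum>k<n. ennreal (level k * radius k x)) \<le> energy x" .
  have "(\<Sum>k<n. ennreal (level k * radius k x)) =
      ennreal (4/3) * (ennreal (3/4) * (\<Sum>k<n. ennreal (level k * radius k x)))"
    by (subst mult.assoc[symmetric]) (simp add: ennreal_mult[symmetric])
  also have "\<dots> \<le> ennreal (4/3) * energy x"
    by (intro mult_left_mono le) simp
  finally show ?thesis by (simp only: ennreal_4_3)
qed

lemma level_radius_le: "ennreal (level k * radius k x) \<le> 4 / 3 * energy x"
proof -
  have "ennreal (level k * radius k x) \<le> (\<Sum>i<Suc k. ennreal (level i * radius i x))"
    by simp
  also note sum_level_radius_le_energy
  finally show ?thesis .
qed

section \<open>Uniform smallness of the radii and separability of the space\<close>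

lemma radius_le_uniform: "radius k x \<le> 4 / 3 * enn2real (majorizing_sup \<phi> m) / level k"
proof -
  have "ennreal (level k * radius k x) \<le> 4 / 3 * majorizing_sup \<phi> m"
    using level_radius_le[of k x] mult_left_mono[OF energy_le[of x], of "4 / 3"] by simp
  also have "\<dots> = ennreal (4 / 3 * enn2real (majorizing_sup \<phi> m))"
    using majorizing by (subst ennreal_mult) (auto simp: ennreal_4_3)
  finally have "level k * radius k x \<le> 4 / 3 * enn2real (majorizing_sup \<phi> m)"
    by (simp add: ennreal_le_iff)
  then show ?thesis using level_pos[of k] by (simp add: field_simps)
qed

text \<open>The products \<open>level k * radius k x\<close> are bounded independently of
  \<open>x\<close> while the levels grow geometrically. Uniformity matters for the nets, where the
  radius at an unknown net point must be small as well.\<close>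

lemma radius_tendsto_uniform:
  assumes "0 < e"
  shows "\<forall>\<^sub>F k in sequentially. \<forall>x. radius k x < e"
proof -
  have "(\<lambda>k. 4 / 3 * enn2real (majorizing_sup \<phi> m) / level k) \<longlonglongrightarrow> 0"
    using LIMSEQ_divide_realpow_zero[of 4 "4 / 3 * enn2real (majorizing_sup \<phi> m) / inv_into {0..} \<phi> 1"]
    by (simp add: level_def mult.assoc)
  then have "\<forall>\<^sub>F k in sequentially. 4 / 3 * enn2real (majorizing_sup \<phi> m) / level k < e"
    using assms by (rule order_tendstoD)
  then show ?thesis
    by eventually_elim (use radius_le_uniform le_less_trans in blast)
qed

text \<open>A maximal family of disjoint balls \<open>B(x, r\<^sub>k(x))\<close> exists because each of them has measure at
  least \<open>1 / \<phi>(a\<^sub>k)\<close>.\<close>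
lemma finite_net:
  "\<exists>F. finite F \<and> (\<forall>x. \<exists>y\<in>F. dist x y \<le> radius k x + radius k y)"
proof -
  define P where "P n \<longleftrightarrow> (\<exists>F. finite F \<and> card F = n \<and>
      disjoint_family_on (\<lambda>x. cball x (radius k x)) F)" for n
  have bound: "n \<le> nat \<lceil>\<phi> (level k)\<rceil>" if "P n" for n
  proof -
    obtain F where F: "finite F" "card F = n" "disjoint_family_on (\<lambda>x. cball x (radius k x)) F"
      using \<open>P n\<close> by (auto simp: P_def)
    have "real n = (\<Sum>x\<in>F. 1)" using F by simp
    also have "\<dots> \<le> (\<Sum>x\<in>F. \<phi> (level k) * measure m (cball x (radius k x)))"
      by (intro sum_mono measure_cball_radius)
    also have "\<dots> = \<phi> (level k) * measure m (\<Union>x\<in>F. cball x (radius k x))"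
      using F by (subst finite_measure_finite_Union) (auto simp: sum_distrib_left)
    also have "\<dots> \<le> \<phi> (level k)"
      using phi_level_ge_1[of k] by (intro mult_left_le) auto
    finally show ?thesis by linarith
  qed
  have "P 0" unfolding P_def by (intro exI[of _ "{}"]) (auto simp: disjoint_family_on_def)
  then obtain N where N: "P N" "\<And>n. P n \<Longrightarrow> n \<le> N"
    using ex_has_greatest_nat[of P 0 id "Suc (nat \<lceil>\<phi> (level k)\<rceil>)"] bound
    by (auto simp: less_Suc_eq_le)
  then obtain F where F: "finite F" "card F = N" "disjoint_family_on (\<lambda>x. cball x (radius k x)) F"
    by (auto simp: P_def)
  have "\<exists>y\<in>F. dist x y \<le> radius k x + radius k y" for x
  proof (cases "x \<in> F")
    case True
    then show ?thesis using radius_nonneg by (intro bexI[of _ x]) auto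
  next
    case False
    have "\<not> P (Suc N)" using N(2) by fastforce
    then have "\<not> disjoint_family_on (\<lambda>x. cball x (radius k x)) (insert x F)"
      using False F unfolding P_def by (metis card_insert_disjoint finite_insert)
    then have "cball x (radius k x) \<inter> (\<Union>y\<in>F. cball y (radius k y)) \<noteq> {}"
      using False F by (simp add: disjoint_family_on_insert)
    then obtain y z where "y \<in> F" "dist x z \<le> radius k x" "dist y z \<le> radius k y"
      by auto
    then show ?thesis using dist_triangle2[of x y z] by (intro bexI[of _ y]) auto
  qed
  then show ?thesis using F by blast
qed

text \<open>The union over \<open>k\<close> of the finite nets is dense, because the net at stage
  \<open>k\<close> has mesh at most twice the supremum of \<open>radius k\<close>.\<close>

lemma countable_dense:
  "\<exists>C :: 'a set. countable C \<and> (\<forall>x. \<forall>e>0. \<exists>c\<in>C. dist x c < e)"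
proof -
  obtain F where F: "\<And>k. finite (F k)" "\<And>k x. \<exists>y\<in>F k. dist x y \<le> radius k x + radius k y"
    using finite_net by metis
  show ?thesis
  proof (intro exI[of _ "\<Union>k. F k"] conjI allI impI)
    show "countable (\<Union>k. F k)" using F by (auto intro: countable_finite)
    fix x :: 'a and e :: real assume "0 < e"
    then obtain k where k: "\<And>x. radius k x < e / 2"
      using radius_tendsto_uniform[of "e / 2"] by (auto simp: eventually_sequentially)
    obtain y where "y \<in> F k" "dist x y \<le> radius k x + radius k y" using F by blast
    then show "\<exists>c\<in>(\<Union>k. F k). dist x c < e"
      using k[of x] k[of y] by (intro bexI[of _ y]) auto
  qed
qed

text \<open>The type of points need not be second countable, so \<open>borel_prod\<close> does not apply directly.\<close>
lemma sets_pair [measurable_cong]: "sets (m \<Otimes>\<^sub>M m) = sets (borel :: ('a \<times> 'a) measure)"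
proof -
  obtain C :: "'a set" where C: "countable C" "\<And>x e. 0 < e \<Longrightarrow> \<exists>c\<in>C. dist x c < e"
    using countable_dense by blast
  obtain B :: "'a set set" where "countable B" "topological_basis B"
    using countable_dense_imp_basis[OF C] by blast
  then have "sets (borel \<Otimes>\<^sub>M borel) = sets (borel :: ('a \<times> 'a) measure)"
    by (rule sets_borel_pair_basis)
  moreover have "sets (m \<Otimes>\<^sub>M m) = sets (borel \<Otimes>\<^sub>M borel)"
    by (intro sets_pair_measure_cong) auto
  ultimately show ?thesis by simp
qed

lemma continuous_imp_measurable_pair:
  fixes g :: "'a \<times> 'a \<Rightarrow> 'b::topological_space"
  assumes "continuous_on UNIV g"
  shows "g \<in> borel_measurable (m \<Otimes>\<^sub>M m)"
  using borel_measurable_continuous_onI[OF assms] measurable_cong_sets[OF sets_pair refl] by blast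

lemma measurable_radius [measurable]: "radius k \<in> borel_measurable m"
  using borel_measurable_continuous_onI[OF continuous_on_radius] by simp

section \<open>The chaining density on pairs and its normalisation\<close>

definition ball_rel :: "nat \<Rightarrow> ('a \<times> 'a) set" where
  "ball_rel k = {p. dist (fst p) (snd p) \<le> radius k (fst p)}"

lemma indicator_ball_rel: "indicator (ball_rel k) (u, v) = indicator (cball u (radius k u)) v"
  by (auto simp: ball_rel_def indicator_def)

lemma ball_rel_sets [measurable]: "ball_rel k \<in> sets (m \<Otimes>\<^sub>M m)"
proof -
  have "continuous_on UNIV (\<lambda>p. radius k (fst p :: 'a) :: real)"
    by (rule continuous_on_compose2[OF continuous_on_radius]) (auto intro: continuous_intros)
  then have "closed (ball_rel k)"
    unfolding ball_rel_def by (intro closed_Collect_le continuous_intros)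
  then show ?thesis unfolding sets_pair by (rule borel_closed)
qed

lemma measurable_measure_ball [measurable]:
  "(\<lambda>u. measure m (cball u (radius k u))) \<in> borel_measurable m"
proof -
  have "(\<lambda>u. emeasure m (Pair u -` ball_rel k)) \<in> borel_measurable m"
    by (rule measurable_emeasure_Pair) measurable
  moreover have "Pair u -` ball_rel k = cball u (radius k u)" for u
    by (auto simp: ball_rel_def)
  ultimately show ?thesis unfolding measure_def by simp
qed

text \<open>Level \<open>Suc k\<close> is paired with radius \<open>k\<close> because the next
  average is over balls of radius \<open>radius (Suc k)\<close>, whose measure is at least
  \<open>1 / \<phi> (level (Suc k))\<close>. The division by the ball measure turns an integral over
  the ball into an average.\<close>

definition weight :: "nat \<Rightarrow> 'a \<Rightarrow> real" where
  "weight k u = level (Suc k) * radius k u / measure m (cball u (radius k u))"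

lemma measurable_weight [measurable]: "weight k \<in> borel_measurable m"
  unfolding weight_def by measurable

text \<open>The section at \<open>u\<close> of the \<open>k\<close>-th summand of
  \<open>chain_density\<close>, integrated against \<open>g\<close>.\<close>

definition shell :: "nat \<Rightarrow> ('a \<times> 'a \<Rightarrow> ennreal) \<Rightarrow> 'a \<Rightarrow> ennreal" where
  "shell k g u = ennreal (weight k u) * (\<integral>\<^sup>+ v. g (u, v) * indicator (cball u (radius k u)) v \<partial>m)"

definition chain_density :: "'a \<times> 'a \<Rightarrow> ennreal" where
  "chain_density p = (\<Sum>k. ennreal (weight k (fst p)) * indicator (ball_rel k) p)"

lemma measurable_chain_density [measurable]: "chain_density \<in> borel_measurable (m \<Otimes>\<^sub>M m)"
  unfolding chain_density_def by measurable

lemma measurable_shell: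
  assumes [measurable]: "g \<in> borel_measurable (m \<Otimes>\<^sub>M m)"
  shows "shell k g \<in> borel_measurable m"
  unfolding shell_def indicator_ball_rel[symmetric] by measurable

lemma nn_integral_chain_density:
  assumes [measurable]: "g \<in> borel_measurable (m \<Otimes>\<^sub>M m)"
  shows "(\<integral>\<^sup>+ p. chain_density p * g p \<partial>(m \<Otimes>\<^sub>M m)) = (\<Sum>k. \<integral>\<^sup>+ u. shell k g u \<partial>m)"
proof -
  have "(\<integral>\<^sup>+ p. chain_density p * g p \<partial>(m \<Otimes>\<^sub>M m)) =
      (\<integral>\<^sup>+ p. (\<Sum>k. ennreal (weight k (fst p)) * indicator (ball_rel k) p * g p) \<partial>(m \<Otimes>\<^sub>M m))"
    unfolding chain_density_def by (simp add: ennreal_suminf_multc)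
  also have "\<dots> = (\<Sum>k. \<integral>\<^sup>+ p. ennreal (weight k (fst p)) * indicator (ball_rel k) p * g p \<partial>(m \<Otimes>\<^sub>M m))"
    by (intro nn_integral_suminf) measurable
  also have "\<dots> = (\<Sum>k. \<integral>\<^sup>+ u. shell k g u \<partial>m)"
  proof (rule suminf_cong)
    fix k
    have "(\<integral>\<^sup>+ p. ennreal (weight k (fst p)) * indicator (ball_rel k) p * g p \<partial>(m \<Otimes>\<^sub>M m)) =
       (\<integral>\<^sup>+ u. \<integral>\<^sup>+ v. ennreal (weight k u) * (g (u, v) * indicator (ball_rel k) (u, v)) \<partial>m \<partial>m)"
      by (subst nn_integral_fst[symmetric]) (auto simp: mult_ac)
    also have "\<dots> = (\<integral>\<^sup>+ u. shell k g u \<partial>m)"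
      unfolding shell_def
      by (intro nn_integral_cong, subst nn_integral_cmult) (measurable, simp add: indicator_ball_rel)
    finally show "(\<integral>\<^sup>+ p. ennreal (weight k (fst p)) * indicator (ball_rel k) p * g p \<partial>(m \<Otimes>\<^sub>M m)) =
      (\<integral>\<^sup>+ u. shell k g u \<partial>m)" .
  qed
  finally show ?thesis .
qed

definition total_mass :: ennreal where
  "total_mass = (\<Sum>k. \<integral>\<^sup>+ u. shell k (\<lambda>_. 1) u \<partial>m)"

lemma shell_one: "shell k (\<lambda>_. 1) u = ennreal (level (Suc k) * radius k u)"
proof -
  have "shell k (\<lambda>_. 1) u = ennreal (weight k u) * ennreal (measure m (cball u (radius k u)))"
    unfolding shell_def by (simp add: emeasure_eq_measure)
  also have "\<dots> = ennreal (level (Suc k) * radius k u)"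
    using measure_cball_radius_pos[of u k] level_pos[of "Suc k"] radius_nonneg[of k u]
    by (simp add: weight_def ennreal_mult[symmetric])
  finally show ?thesis .
qed

text \<open>By \<open>shell_one\<close> the ball measures cancel, and the shift from
  \<open>level k\<close> to \<open>level (Suc k)\<close> costs a factor 4, giving
  \<open>4 * (4/3)\<close>.\<close>

lemma total_mass_le: "total_mass \<le> 16 / 3 * majorizing_sup \<phi> m"
  unfolding total_mass_def
proof (rule suminf_le_const)
  fix n
  have "(\<Sum>k<n. \<integral>\<^sup>+ u. shell k (\<lambda>_. 1) u \<partial>m) = (\<integral>\<^sup>+ u. (\<Sum>k<n. shell k (\<lambda>_. 1) u) \<partial>m)"
    by (intro nn_integral_sum[symmetric] measurable_shell) auto
  also have "\<dots> \<le> (\<integral>\<^sup>+ u. 16 / 3 * majorizing_sup \<phi> m \<partial>m)"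
  proof (rule nn_integral_mono)
    fix u
    have "(\<Sum>k<n. shell k (\<lambda>_. 1) u) = 4 * (\<Sum>k<n. ennreal (level k * radius k u))"
      using level_pos radius_nonneg
      by (auto simp: shell_one level_Suc sum_distrib_left mult.assoc ennreal_mult less_imp_le intro!: sum.cong)
    also have "\<dots> \<le> 4 * (ennreal (4/3) * majorizing_sup \<phi> m)"
      unfolding ennreal_4_3[symmetric]
      by (intro mult_left_mono order_trans[OF sum_level_radius_le_energy] energy_le) auto
    also have "\<dots> = ennreal (16/3) * majorizing_sup \<phi> m"
      by (simp add: mult.assoc[symmetric] ennreal_mult[symmetric] flip: ennreal_numeral)
    also have "ennreal (16/3) = 16 / 3"
      by (simp add: divide_ennreal[symmetric])
    finally show "(\<Sum>k<n. shell k (\<lambda>_. 1) u) \<le> 16 / 3 * majorizing_sup \<phi> m" .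
  qed
  also have "\<dots> = 16 / 3 * majorizing_sup \<phi> m"
    using emeasure_space_1 by simp
  finally show "(\<Sum>k<n. \<integral>\<^sup>+ u. shell k (\<lambda>_. 1) u \<partial>m) \<le> 16 / 3 * majorizing_sup \<phi> m" .
qed auto

text \<open>Two distinct points both lie in every critical ball of level 0, which bounds
  \<open>radius 0\<close> below by half their distance, uniformly in the centre.\<close>

lemma total_mass_pos:
  fixes x y :: 'a
  assumes "x \<noteq> y"
  shows "0 < total_mass"
proof -
  have *: "dist x y / 2 \<le> radius 0 u" for u
  proof -
    have "x \<in> cball u (radius 0 u)" "y \<in> cball u (radius 0 u)"
      by (simp_all add: cball_radius_0)
    then show ?thesis using dist_triangle3[of x y u] by simp
  qed
  have "0 < ennreal (level (Suc 0) * (dist x y / 2))"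
    using assms level_pos[of "Suc 0"] by simp
  also have "\<dots> = (\<integral>\<^sup>+ u. ennreal (level (Suc 0) * (dist x y / 2)) \<partial>m)"
    using emeasure_space_1 by simp
  also have "\<dots> \<le> (\<integral>\<^sup>+ u. shell 0 (\<lambda>_. 1) u \<partial>m)"
    using * level_pos[of "Suc 0"]
    by (intro nn_integral_mono) (auto simp: shell_one intro!: ennreal_leI mult_left_mono)
  also have "\<dots> = (\<Sum>k<Suc 0. \<integral>\<^sup>+ u. shell k (\<lambda>_. 1) u \<partial>m)"
    by simp
  also have "\<dots> \<le> total_mass"
    unfolding total_mass_def by (intro sum_le_suminf) auto
  finally show ?thesis .
qed

definition chain_measure :: "('a \<times> 'a) measure" where
  "chain_measure = density (m \<Otimes>\<^sub>M m) (\<lambda>p. chain_density p / total_mass)"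

lemma sets_chain_measure: "sets chain_measure = sets borel"
  unfolding chain_measure_def sets_density sets_pair ..

lemma total_mass_finite: "total_mass < \<infinity>"
  using total_mass_le majorizing
  by (metis ennreal_4_3 ennreal_mult_less_top ennreal_numeral divide_ennreal ennreal_less_top infinity_ennreal_def
      le_less_trans zero_le_numeral zero_less_numeral)

text \<open>The normalising constant cancels because it is both positive and finite.\<close>

lemma nn_integral_chain_measure:
  assumes [measurable]: "g \<in> borel_measurable (m \<Otimes>\<^sub>M m)" and "0 < total_mass"
  shows "total_mass * (\<integral>\<^sup>+ p. g p \<partial>chain_measure) = (\<Sum>k. \<integral>\<^sup>+ u. shell k g u \<partial>m)"
proof -
  have "total_mass * (\<integral>\<^sup>+ p. g p \<partial>chain_measure) =
      (\<integral>\<^sup>+ p. total_mass * (chain_density p / total_mass * g p) \<partial>(m \<Otimes>\<^sub>M m))"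
    unfolding chain_measure_def by (simp add: nn_integral_density nn_integral_cmult)
  also have "\<dots> = (\<integral>\<^sup>+ p. chain_density p * g p \<partial>(m \<Otimes>\<^sub>M m))"
  proof (rule nn_integral_cong)
    fix p
    have "total_mass * (chain_density p / total_mass) = chain_density p"
      using assms(2) total_mass_finite
      by (subst ennreal_times_divide, subst mult.commute, subst ennreal_mult_divide_eq) auto
    then show "total_mass * (chain_density p / total_mass * g p) = chain_density p * g p"
      by (metis mult.assoc)
  qed
  finally show ?thesis using nn_integral_chain_density assms by simp
qed

lemma prob_space_chain_measure:
  assumes "0 < total_mass"
  shows "prob_space chain_measure"
proof
  have "total_mass * (\<integral>\<^sup>+ p. 1 \<partial>chain_measure) = total_mass"
    using assms by (subst nn_integral_chain_measure) (auto simp: total_mass_def)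
  then have "total_mass * emeasure chain_measure (space chain_measure) = total_mass * 1"
    by simp
  then show "emeasure chain_measure (space chain_measure) = 1"
    using assms total_mass_finite by (subst (asm) ennreal_mult_cancel_left) auto
qed

section \<open>Averages over critical balls and a single chaining step\<close>

lemma cball_sets [measurable]: "cball x r \<in> sets m"
  by simp

definition avg :: "nat \<Rightarrow> ('a \<Rightarrow> real) \<Rightarrow> 'a \<Rightarrow> real" where
  "avg k f x = (\<integral> y. f y * indicator (cball x (radius k x)) y \<partial>m) / measure m (cball x (radius k x))"

lemma avg_0: "avg 0 f x = (\<integral> y. f y \<partial>m)"
  using prob_space by (simp add: avg_def cball_radius_0)

text \<open>The constant \<open>c\<close> is free because it is later a value of \<open>f\<close> as
  well as the mean of \<open>f\<close>. Boundedness provides integrability, and the nonnegative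
  integral on the right allows infinite bounds afterwards.\<close>

lemma abs_avg_diff_le:
  fixes f :: "'a \<Rightarrow> real"
  assumes [measurable]: "f \<in> borel_measurable m" and bdd: "\<And>x. \<bar>f x\<bar> \<le> K"
  shows "ennreal \<bar>avg k f x - c\<bar> \<le> ennreal (1 / measure m (cball x (radius k x))) *
    (\<integral>\<^sup>+ y. ennreal \<bar>f y - c\<bar> * indicator (cball x (radius k x)) y \<partial>m)"
proof -
  let ?B = "cball x (radius k x)"
  have pos: "0 < measure m ?B" by (rule measure_cball_radius_pos)
  have int: "integrable m (\<lambda>y. f y * indicator ?B y)"
  proof (rule integrable_const_bound[of _ K])
    show "AE y in m. norm (f y * indicator ?B y) \<le> K"
      using bdd order_trans[OF abs_ge_zero bdd] by (auto simp: indicator_def)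
  qed measurable
  have intc: "integrable m (\<lambda>y. c * indicator ?B y)"
    by (intro integrable_mult_right integrable_real_indicator) (auto simp: emeasure_eq_measure)
  have eq: "(\<lambda>y. (f y - c) * indicator ?B y) = (\<lambda>y. f y * indicator ?B y - c * indicator ?B y)"
    by (auto simp: algebra_simps)
  have int': "integrable m (\<lambda>y. (f y - c) * indicator ?B y)"
    unfolding eq using int intc by (rule Bochner_Integration.integrable_diff)
  have "(\<integral> y. (f y - c) * indicator ?B y \<partial>m) = (\<integral> y. f y * indicator ?B y \<partial>m) - c * measure m ?B"
    unfolding eq using int intc by (subst Bochner_Integration.integral_diff) auto
  then have "avg k f x - c = (1 / measure m ?B) * (\<integral> y. (f y - c) * indicator ?B y \<partial>m)"
    using pos by (simp add: avg_def field_simps)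
  then have "\<bar>avg k f x - c\<bar> = (1 / measure m ?B) * \<bar>\<integral> y. (f y - c) * indicator ?B y \<partial>m\<bar>"
    using pos by (simp add: abs_mult)
  also have "\<dots> \<le> (1 / measure m ?B) * (\<integral> y. \<bar>(f y - c) * indicator ?B y\<bar> \<partial>m)"
    using pos by (intro mult_left_mono integral_abs_bound) auto
  finally have "ennreal \<bar>avg k f x - c\<bar> \<le> ennreal (1 / measure m ?B) * ennreal (\<integral> y. \<bar>(f y - c) * indicator ?B y\<bar> \<partial>m)"
    by (subst ennreal_mult[symmetric]) (auto intro: ennreal_leI)
  also have "ennreal (\<integral> y. \<bar>(f y - c) * indicator ?B y\<bar> \<partial>m) = (\<integral>\<^sup>+ y. ennreal \<bar>(f y - c) * indicator ?B y\<bar> \<partial>m)"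
    using int' by (intro nn_integral_eq_integral[symmetric] integrable_abs) auto
  also have "\<dots> = (\<integral>\<^sup>+ y. ennreal \<bar>f y - c\<bar> * indicator ?B y \<partial>m)"
    by (intro nn_integral_cong) (auto simp: indicator_def)
  finally show ?thesis .
qed

text \<open>Division by zero yields zero, so the diagonal contributes
  \<open>\<phi> 0 = 0\<close>.\<close>

definition slope :: "('a \<Rightarrow> real) \<Rightarrow> 'a \<times> 'a \<Rightarrow> ennreal" where
  "slope f p = ennreal (\<phi> (\<bar>f (fst p) - f (snd p)\<bar> / dist (fst p) (snd p)))"

lemma measurable_slope:
  assumes "continuous_on UNIV f"
  shows "slope f \<in> borel_measurable (m \<Otimes>\<^sub>M m)"
proof -
  have [measurable]: "(\<lambda>p. \<bar>f (fst p) - f (snd p)\<bar>) \<in> borel_measurable (m \<Otimes>\<^sub>M m)"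
    by (intro continuous_imp_measurable_pair continuous_intros continuous_on_compose2[OF assms]) auto
  have [measurable]: "(\<lambda>p. dist (fst p) (snd p) :: real) \<in> borel_measurable (m \<Otimes>\<^sub>M m)"
    by (intro continuous_imp_measurable_pair continuous_intros)
  note [measurable] = measurable_young_function[OF young]
  have "(\<lambda>p. ennreal (\<phi> (max 0 (\<bar>f (fst p) - f (snd p)\<bar> / dist (fst p) (snd p))))) \<in> borel_measurable (m \<Otimes>\<^sub>M m)"
    by measurable
  then show ?thesis unfolding slope_def by (simp add: max_def)
qed

text \<open>Pointwise on the ball the increment is at most the radius times the slope, and
  \<open>young_function_le_add\<close> with \<open>a = level (Suc k)\<close> splits the slope.
  Averaging the two parts gives the two terms.\<close>

lemma avg_step:
  fixes f :: "'a \<Rightarrow> real"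
  assumes cont: "continuous_on UNIV f" and bdd: "\<And>x. \<bar>f x\<bar> \<le> K"
  shows "ennreal \<bar>avg k f y - f y\<bar> \<le> ennreal (level (Suc k) * radius k y) +
    ennreal (1 / \<phi> (level (Suc k))) * shell k (slope f) y"
proof -
  let ?B = "cball y (radius k y)" and ?a = "level (Suc k)" and ?r = "radius k y"
  let ?\<mu> = "measure m ?B"
  have [measurable]: "f \<in> borel_measurable m" "slope f \<in> borel_measurable (m \<Otimes>\<^sub>M m)"
    using borel_measurable_continuous_onI[OF cont] measurable_slope[OF cont] by simp_all
  have pos: "0 < ?\<mu>" "0 < ?a" "0 \<le> ?r" "0 < \<phi> ?a"
    using measure_cball_radius_pos level_pos radius_nonneg young_function_pos[OF young level_pos] by auto
  have ptw: "ennreal \<bar>f v - f y\<bar> * indicator ?B v \<le>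
     ennreal (?a * ?r) * indicator ?B v + ennreal (?a * ?r / \<phi> ?a) * (slope f (y, v) * indicator ?B v)" for v
  proof (cases "v \<in> ?B")
    case True
    define q where "q = \<bar>f y - f v\<bar> / dist y v"
    have q: "0 \<le> q" by (simp add: q_def)
    \<comment> \<open>This also holds for \<open>v = y\<close>, where both sides are 0.\<close>
    have "\<bar>f v - f y\<bar> = dist y v * q" by (auto simp: q_def)
    also have "\<dots> \<le> ?r * q" using True q by (intro mult_right_mono) auto
    also have "\<dots> \<le> ?r * (?a + ?a / \<phi> ?a * \<phi> q)"
      using young q pos by (intro mult_left_mono young_function_le_add) auto
    finally have "\<bar>f v - f y\<bar> \<le> ?a * ?r + ?a * ?r / \<phi> ?a * \<phi> q"
      by (simp add: algebra_simps)
    then have "ennreal \<bar>f v - f y\<bar> \<le> ennreal (?a * ?r + ?a * ?r / \<phi> ?a * \<phi> q)"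
      by (rule ennreal_leI)
    also have "\<dots> = ennreal (?a * ?r) + ennreal (?a * ?r / \<phi> ?a) * ennreal (\<phi> q)"
      using pos young_function_nonneg[OF young q]
      by (subst ennreal_plus) (auto simp: ennreal_mult'[symmetric])
    finally show ?thesis using True by (simp add: slope_def q_def)
  qed simp
  have "ennreal \<bar>avg k f y - f y\<bar> \<le> ennreal (1 / ?\<mu>) *
      (\<integral>\<^sup>+ v. ennreal \<bar>f v - f y\<bar> * indicator ?B v \<partial>m)"
    using bdd by (intro abs_avg_diff_le) auto
  also have "\<dots> \<le> ennreal (1 / ?\<mu>) * (\<integral>\<^sup>+ v. ennreal (?a * ?r) * indicator ?B v +
      ennreal (?a * ?r / \<phi> ?a) * (slope f (y, v) * indicator ?B v) \<partial>m)"
    by (intro mult_left_mono nn_integral_mono ptw) auto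
  also have "\<dots> = ennreal (1 / ?\<mu>) * (ennreal (?a * ?r) * ennreal ?\<mu> +
      ennreal (?a * ?r / \<phi> ?a) * (\<integral>\<^sup>+ v. slope f (y, v) * indicator ?B v \<partial>m))"
    by (subst nn_integral_add) (auto simp: nn_integral_cmult emeasure_eq_measure nn_integral_cmult_indicator)
  also have "\<dots> = ennreal (1 / ?\<mu>) * (ennreal (?a * ?r) * ennreal ?\<mu>) +
      ennreal (1 / ?\<mu>) * ennreal (?a * ?r / \<phi> ?a) * (\<integral>\<^sup>+ v. slope f (y, v) * indicator ?B v \<partial>m)"
    by (simp add: distrib_left mult.assoc)
  also have "ennreal (1 / ?\<mu>) * (ennreal (?a * ?r) * ennreal ?\<mu>) = ennreal (?a * ?r)"
    using pos by (simp add: ennreal_mult[symmetric])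
  also have "ennreal (1 / ?\<mu>) * ennreal (?a * ?r / \<phi> ?a) = ennreal (1 / \<phi> ?a) * ennreal (weight k y)"
    using pos by (simp add: ennreal_mult[symmetric] weight_def mult.commute)
  finally show ?thesis by (simp add: shell_def mult.assoc)
qed

section \<open>Drift terms and the chaining induction\<close>

text \<open>Chosen so that \<open>a\<^sub>l\<^sub>+\<^sub>1 r\<^sub>l(y) + drift l y \<le> drift (l + 1) x\<close> for \<open>y\<close> in \<open>B(x, r\<^sub>l\<^sub>+\<^sub>1(x))\<close>.\<close>
definition drift :: "nat \<Rightarrow> 'a \<Rightarrow> real" where
  "drift l x = (\<Sum>k<l. level (Suc k) * (radius k x + 2 * radius (Suc k) x))"

lemma drift_nonneg: "0 \<le> drift l x"
  unfolding drift_def using level_pos radius_nonneg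
  by (intro sum_nonneg mult_nonneg_nonneg add_nonneg_nonneg) (auto simp: less_imp_le)

lemma sum_level_le: "(\<Sum>k<l. 3 * level (Suc k)) \<le> level (Suc l)"
  using level_pos by (induction l) (auto simp: less_imp_le level_Suc)

text \<open>Each \<open>radius k + 2 * radius (Suc k)\<close> has Lipschitz constant 3, and
  \<open>sum_level_le\<close> absorbs the resulting sum into the next level.\<close>

lemma drift_lipschitz: "drift l y \<le> drift l x + level (Suc l) * dist x y"
proof -
  have "drift l y \<le> (\<Sum>k<l. level (Suc k) * (radius k x + 2 * radius (Suc k) x) + 3 * level (Suc k) * dist x y)"
    unfolding drift_def
  proof (rule sum_mono)
    fix k
    have "level (Suc k) * (radius k y + 2 * radius (Suc k) y) \<le>
        level (Suc k) * (radius k x + 2 * radius (Suc k) x + 3 * dist x y)"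
      using radius_lipschitz[of k y x] radius_lipschitz[of "Suc k" y x] level_pos[of "Suc k"]
      by (intro mult_left_mono) auto
    then show "level (Suc k) * (radius k y + 2 * radius (Suc k) y) \<le>
      level (Suc k) * (radius k x + 2 * radius (Suc k) x) + 3 * level (Suc k) * dist x y"
      by (simp add: algebra_simps)
  qed
  also have "\<dots> = drift l x + (\<Sum>k<l. 3 * level (Suc k)) * dist x y"
    by (simp add: sum.distrib drift_def sum_distrib_right)
  also have "\<dots> \<le> drift l x + level (Suc l) * dist x y"
    by (intro add_left_mono mult_right_mono sum_level_le) auto
  finally show ?thesis .
qed

text \<open>The first part of each summand costs 4 through the index shift and the second costs 2;
  then \<open>6 * (4/3) = 8\<close>.\<close>

lemma drift_le_energy: "ennreal (drift l x) \<le> 8 * energy x"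
proof -
  let ?s = "\<lambda>n. (\<Sum>k<n. level k * radius k x)"
  have nn: "0 \<le> level k * radius k x" for k
    using level_pos[of k] radius_nonneg[of k x] by simp
  have "drift l x = 4 * ?s l + 2 * (\<Sum>k<l. level (Suc k) * radius (Suc k) x)"
    unfolding drift_def sum_distrib_left sum.distrib[symmetric]
    by (intro sum.cong) (auto simp: level_Suc algebra_simps)
  also have "(\<Sum>k<l. level (Suc k) * radius (Suc k) x) \<le> ?s (Suc l)"
    using nn[of 0] by (subst sum.lessThan_Suc_shift) simp
  also have "?s l \<le> ?s (Suc l)" using nn by simp
  finally have "drift l x \<le> 6 * ?s (Suc l)" by simp
  then have "ennreal (drift l x) \<le> ennreal 6 * ennreal (?s (Suc l))"
    using nn by (subst ennreal_mult[symmetric]) (auto simp del: sum.lessThan_Suc intro!: sum_nonneg ennreal_leI)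
  also have "ennreal (?s (Suc l)) = (\<Sum>k<Suc l. ennreal (level k * radius k x))"
    using nn by (intro sum_ennreal[symmetric]) auto
  also have "ennreal 6 * \<dots> \<le> ennreal 6 * (4 / 3 * energy x)"
    by (intro mult_left_mono sum_level_radius_le_energy) auto
  also have "\<dots> = 8 * energy x"
    unfolding ennreal_4_3 mult.assoc[symmetric] by (subst ennreal_mult[symmetric]) auto
  finally show ?thesis .
qed

text \<open>At a point \<open>y\<close> of the ball about \<open>x\<close>, \<open>avg_step\<close>
  compares \<open>f y\<close> with \<open>avg l f y\<close> and the induction hypothesis compares
  that with the mean. Averaging over \<open>y\<close> then gives the bound for
  \<open>avg (Suc l) f x\<close>.\<close>

lemma avg_chain:
  fixes f :: "'a \<Rightarrow> real"
  assumes cont: "continuous_on UNIV f" and bdd: "\<And>x. \<bar>f x\<bar> \<le> K"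
  shows "ennreal \<bar>avg l f x - (\<integral> y. f y \<partial>m)\<bar> \<le>
    ennreal (drift l x) + (\<Sum>k<l. \<integral>\<^sup>+ u. shell k (slope f) u \<partial>m)"
proof (induction l arbitrary: x)
  case 0
  then show ?case by (simp add: avg_0)
next
  case (Suc l)
  let ?c = "\<integral> y. f y \<partial>m" and ?W = "\<Sum>k<l. \<integral>\<^sup>+ u. shell k (slope f) u \<partial>m"
  let ?B = "cball x (radius (Suc l) x)" and ?a = "level (Suc l)"
  let ?\<mu> = "measure m ?B" and ?D = "ennreal (drift (Suc l) x)"
  have [measurable]: "f \<in> borel_measurable m" "shell l (slope f) \<in> borel_measurable m"
    using borel_measurable_continuous_onI[OF cont] measurable_shell[OF measurable_slope[OF cont]] by simp_all
  have pos: "0 < ?\<mu>" "0 < ?a" "0 < \<phi> ?a"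
    using measure_cball_radius_pos level_pos young_function_pos[OF young level_pos] by auto
  \<comment> \<open>The last term carries no indicator, so its integral runs over the whole space
    and does not depend on \<open>x\<close>.\<close>
  have ptw: "ennreal \<bar>f y - ?c\<bar> * indicator ?B y \<le>
     (?D + ?W) * indicator ?B y + ennreal (1 / \<phi> ?a) * shell l (slope f) y" for y
  proof (cases "y \<in> ?B")
    case True
    have "ennreal \<bar>f y - ?c\<bar> \<le> ennreal (\<bar>avg l f y - f y\<bar> + \<bar>avg l f y - ?c\<bar>)"
      by (intro ennreal_leI) linarith
    also have "\<dots> = ennreal \<bar>avg l f y - f y\<bar> + ennreal \<bar>avg l f y - ?c\<bar>"
      by (simp add: ennreal_plus)
    also have "\<dots> \<le> (ennreal (?a * radius l y) + ennreal (1 / \<phi> ?a) * shell l (slope f) y) +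
        (ennreal (drift l y) + ?W)"
      by (intro add_mono avg_step[OF cont bdd] Suc)
    also have "\<dots> = ennreal (?a * radius l y + drift l y) + ?W + ennreal (1 / \<phi> ?a) * shell l (slope f) y"
      using pos radius_nonneg[of l y] drift_nonneg[of l y] by (simp add: ennreal_plus ac_simps)
    \<comment> \<open>Of the two copies of \<open>radius (Suc l) x\<close> in the new summand of
      \<open>drift\<close>, one pays for moving \<open>radius l\<close> from \<open>y\<close> to
      \<open>x\<close> and the other for moving \<open>drift l\<close>.\<close>
    also have "ennreal (?a * radius l y + drift l y) \<le> ?D"
    proof (rule ennreal_leI)
      have d: "dist x y \<le> radius (Suc l) x" using True by simp
      have "?a * radius l y \<le> ?a * (radius l x + radius (Suc l) x)"
        using radius_lipschitz[of l y x] d pos by (intro mult_left_mono) auto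
      moreover have "drift l y \<le> drift l x + ?a * radius (Suc l) x"
        using drift_lipschitz[of l y x] mult_left_mono[OF d, of ?a] pos by linarith
      ultimately show "?a * radius l y + drift l y \<le> drift (Suc l) x"
        by (simp add: drift_def algebra_simps)
    qed
    finally show ?thesis using True by simp
  qed simp
  have "ennreal \<bar>avg (Suc l) f x - ?c\<bar> \<le> ennreal (1 / ?\<mu>) *
      (\<integral>\<^sup>+ y. ennreal \<bar>f y - ?c\<bar> * indicator ?B y \<partial>m)"
    using bdd by (intro abs_avg_diff_le) auto
  also have "\<dots> \<le> ennreal (1 / ?\<mu>) * (\<integral>\<^sup>+ y. (?D + ?W) * indicator ?B y +
      ennreal (1 / \<phi> ?a) * shell l (slope f) y \<partial>m)"
    by (intro mult_left_mono nn_integral_mono ptw) auto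
  also have "\<dots> = ennreal (1 / ?\<mu>) * ((?D + ?W) * ennreal ?\<mu> +
      ennreal (1 / \<phi> ?a) * (\<integral>\<^sup>+ y. shell l (slope f) y \<partial>m))"
    by (subst nn_integral_add, measurable)
       (simp add: nn_integral_cmult emeasure_eq_measure nn_integral_cmult_indicator)
  also have "\<dots> = (?D + ?W) * (ennreal (1 / ?\<mu>) * ennreal ?\<mu>) +
      (ennreal (1 / ?\<mu>) * ennreal (1 / \<phi> ?a)) * (\<integral>\<^sup>+ y. shell l (slope f) y \<partial>m)"
    by (simp add: distrib_left ac_simps)
  also have "ennreal (1 / ?\<mu>) * ennreal ?\<mu> = 1"
    using pos by (simp add: ennreal_mult[symmetric])
  \<comment> \<open>The price of enlarging the ball to the whole space is cancelled by the
    denominator from \<open>avg_step\<close>, thanks to the lower bound on the ball measure.\<close>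
  also have "ennreal (1 / ?\<mu>) * ennreal (1 / \<phi> ?a) \<le> 1"
    using pos measure_cball_radius[of "Suc l" x]
    by (simp add: ennreal_mult[symmetric] field_simps)
  finally show ?case by (simp add: add.assoc mult_right_mono)
qed

text \<open>Continuity at \<open>x\<close> and shrinking radii make \<open>avg l f x\<close> close
  to \<open>f x\<close> for some \<open>l\<close>, while the chain bound is dominated independently
  of \<open>l\<close>.\<close>

lemma diff_mean_le:
  fixes f :: "'a \<Rightarrow> real"
  assumes cont: "continuous_on UNIV f" and bdd: "\<And>x. \<bar>f x\<bar> \<le> K"
  shows "ennreal \<bar>f x - (\<integral> y. f y \<partial>m)\<bar> \<le> 8 * energy x + (\<Sum>k. \<integral>\<^sup>+ u. shell k (slope f) u \<partial>m)"
proof (rule ennreal_le_epsilon)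
  fix e :: real assume "0 < e"
  let ?c = "\<integral> y. f y \<partial>m"
  have [measurable]: "f \<in> borel_measurable m"
    using borel_measurable_continuous_onI[OF cont] by simp
  obtain d where d: "0 < d" "\<And>y. dist y x < d \<Longrightarrow> \<bar>f y - f x\<bar> < e"
    using cont \<open>0 < e\<close> unfolding continuous_on_iff dist_real_def by (meson UNIV_I)
  obtain l where l: "radius l x < d"
    using radius_tendsto_uniform[OF \<open>0 < d\<close>] by (auto simp: eventually_sequentially)
  let ?B = "cball x (radius l x)"
  have "ennreal \<bar>avg l f x - f x\<bar> \<le> ennreal (1 / measure m ?B) *
      (\<integral>\<^sup>+ y. ennreal \<bar>f y - f x\<bar> * indicator ?B y \<partial>m)"
    using bdd by (intro abs_avg_diff_le) auto
  also have "\<dots> \<le> ennreal (1 / measure m ?B) * (\<integral>\<^sup>+ y. ennreal e * indicator ?B y \<partial>m)"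
  proof (intro mult_left_mono nn_integral_mono)
    fix y
    have "\<bar>f y - f x\<bar> \<le> e" if "y \<in> ?B"
      using d(2)[of y] l that by (simp add: dist_commute)
    then show "ennreal \<bar>f y - f x\<bar> * indicator ?B y \<le> ennreal e * indicator ?B y"
      by (auto simp: indicator_def intro: ennreal_leI)
  qed auto
  also have "\<dots> = ennreal e"
    using \<open>0 < e\<close> measure_cball_radius_pos[of x l]
    by (simp add: nn_integral_cmult_indicator emeasure_eq_measure ennreal_mult[symmetric])
  finally have 1: "ennreal \<bar>avg l f x - f x\<bar> \<le> ennreal e" .
  have "ennreal \<bar>f x - ?c\<bar> \<le> ennreal (\<bar>avg l f x - f x\<bar> + \<bar>avg l f x - ?c\<bar>)"
    by (intro ennreal_leI) linarith
  also have "\<dots> = ennreal \<bar>avg l f x - f x\<bar> + ennreal \<bar>avg l f x - ?c\<bar>"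
    by (simp add: ennreal_plus)
  also have "\<dots> \<le> ennreal e + (ennreal (drift l x) + (\<Sum>k<l. \<integral>\<^sup>+ u. shell k (slope f) u \<partial>m))"
    by (intro add_mono 1 avg_chain[OF cont bdd])
  also have "\<dots> \<le> ennreal e + (8 * energy x + (\<Sum>k. \<integral>\<^sup>+ u. shell k (slope f) u \<partial>m))"
    by (intro add_mono order_refl drift_le_energy sum_le_suminf) auto
  finally show "ennreal \<bar>f x - ?c\<bar> \<le> 8 * energy x + (\<Sum>k. \<integral>\<^sup>+ u. shell k (slope f) u \<partial>m) + ennreal e"
    by (simp add: ac_simps)
qed

section \<open>From the deviation from the mean to the oscillation\<close>

lemma oscillation_bounded:
  fixes f :: "'a \<Rightarrow> real"
  assumes cont: "continuous_on UNIV f" and bdd: "\<And>x. \<bar>f x\<bar> \<le> K" and pos: "0 < total_mass"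
  shows "ennreal \<bar>f s - f t\<bar> \<le> 32 * majorizing_sup \<phi> m *
    (2 / 3 + 1 / 3 * (\<integral>\<^sup>+ p. slope f p \<partial>chain_measure))"
proof -
  let ?c = "\<integral> y. f y \<partial>m" and ?S = "majorizing_sup \<phi> m" and ?I = "\<integral>\<^sup>+ p. slope f p \<partial>chain_measure"
  have *: "ennreal \<bar>f x - ?c\<bar> \<le> 8 * ?S + 16 / 3 * ?S * ?I" for x
  proof -
    have "ennreal \<bar>f x - ?c\<bar> \<le> 8 * energy x + total_mass * ?I"
      using diff_mean_le[OF cont bdd, of x] nn_integral_chain_measure[OF measurable_slope[OF cont] pos] by simp
    also have "\<dots> \<le> 8 * ?S + 16 / 3 * ?S * ?I"
      by (intro add_mono mult_left_mono mult_right_mono energy_le total_mass_le) auto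
    finally show ?thesis .
  qed
  have "ennreal \<bar>f s - f t\<bar> \<le> ennreal (\<bar>f s - ?c\<bar> + \<bar>f t - ?c\<bar>)"
    by (intro ennreal_leI) linarith
  also have "\<dots> = ennreal \<bar>f s - ?c\<bar> + ennreal \<bar>f t - ?c\<bar>"
    by (simp add: ennreal_plus)
  also have "\<dots> \<le> (8 * ?S + 16 / 3 * ?S * ?I) + (8 * ?S + 16 / 3 * ?S * ?I)"
    by (intro add_mono *)
  also have "\<dots> = (8 + 8) * ?S + (16 / 3 + 16 / 3) * (?S * ?I)"
    by (simp only: distrib_right add.assoc add.left_commute mult.assoc)
  \<comment> \<open>The first coefficient has slack, 16 against 64/3; the second is exactly
    32/3.\<close>
  also have "\<dots> \<le> 32 * (2 / 3) * ?S + 32 * (1 / 3) * (?S * ?I)"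
  proof (intro add_mono mult_right_mono)
    have e: "(2 / 3 :: ennreal) = ennreal (2/3)" "(1 / 3 :: ennreal) = ennreal (1/3)" "(16 / 3 :: ennreal) = ennreal (16/3)"
      by (simp_all add: divide_ennreal[symmetric])
    show "(8 + 8 :: ennreal) \<le> 32 * (2 / 3)" "16 / 3 + 16 / 3 \<le> (32 * (1 / 3) :: ennreal)"
      unfolding e by (simp_all add: ennreal_mult[symmetric] ennreal_plus[symmetric] ennreal_le_iff
          del: ennreal_plus flip: ennreal_numeral)
  qed auto
  also have "\<dots> = 32 * ?S * (2 / 3 + 1 / 3 * ?I)"
    by (simp only: distrib_left ac_simps)
  finally show ?thesis .
qed

text \<open>Clipping \<open>f\<close> to \<open>[-K, K]\<close> does not increase any increment,
  hence no slope either, and the choice of \<open>K\<close> leaves the values at \<open>s\<close>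
  and \<open>t\<close> unchanged.\<close>

lemma oscillation:
  fixes f :: "'a \<Rightarrow> real"
  assumes cont: "continuous_on UNIV f" and pos: "0 < total_mass"
  shows "ennreal \<bar>f s - f t\<bar> \<le> 32 * majorizing_sup \<phi> m *
    (2 / 3 + 1 / 3 * (\<integral>\<^sup>+ p. slope f p \<partial>chain_measure))"
proof -
  define K where "K = max \<bar>f s\<bar> \<bar>f t\<bar>"
  define h where "h x = max (- K) (min K (f x))" for x
  have "ennreal \<bar>h s - h t\<bar> \<le> 32 * majorizing_sup \<phi> m *
    (2 / 3 + 1 / 3 * (\<integral>\<^sup>+ p. slope h p \<partial>chain_measure))"
  proof (rule oscillation_bounded[where K=K])
    show "continuous_on UNIV h" unfolding h_def by (intro continuous_intros cont)
    show "\<bar>h x\<bar> \<le> K" for x using abs_ge_zero[of "f s"] by (auto simp: h_def K_def abs_le_iff max_def min_def)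
  qed fact
  also have "\<dots> \<le> 32 * majorizing_sup \<phi> m * (2 / 3 + 1 / 3 * (\<integral>\<^sup>+ p. slope f p \<partial>chain_measure))"
  proof (intro mult_left_mono add_left_mono nn_integral_mono)
    fix p :: "'a \<times> 'a"
    have "\<bar>h (fst p) - h (snd p)\<bar> \<le> \<bar>f (fst p) - f (snd p)\<bar>"
      by (auto simp: h_def)
    then show "slope h p \<le> slope f p"
      unfolding slope_def by (intro ennreal_leI young_function_mono[OF young] divide_right_mono) auto
  qed auto
  also have "h s - h t = f s - f t" by (auto simp: h_def K_def)
  finally show ?thesis .
qed

end

theorem corollary1p2:
  fixes m :: "'a::metric_space measure" and \<phi> :: "real \<Rightarrow> real"
  assumes "prob_space m" and "sets m = sets borel"
    and "measure_support m = UNIV"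
    and "young_function \<phi>"
  shows "\<exists>\<nu> :: ('a \<times> 'a) measure. prob_space \<nu> \<and> sets \<nu> = sets borel \<and>
    (\<forall>f :: 'a \<Rightarrow> real. continuous_on UNIV f \<longrightarrow>
      (SUP s. SUP t. ennreal \<bar>f s - f t\<bar>) \<le>
        32 * majorizing_sup \<phi> m *
          (2 / 3 + 1 / 3 * (\<integral>\<^sup>+ (u, v). ennreal (\<phi> (\<bar>f u - f v\<bar> / dist u v)) \<partial>\<nu>)))"
proof (cases "majorizing_sup \<phi> m < \<infinity> \<and> (\<exists>x y :: 'a. x \<noteq> y)")
  case True
  then interpret majorizing_space m \<phi>
    using assms by (simp add: majorizing_space_def majorizing_space_axioms_def)
  have pos: "0 < total_mass" using True total_mass_pos by blast
  show ?thesis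
  proof (intro exI[of _ chain_measure] conjI allI impI)
    fix f :: "'a \<Rightarrow> real" assume f: "continuous_on UNIV f"
    have "(\<integral>\<^sup>+ (u, v). ennreal (\<phi> (\<bar>f u - f v\<bar> / dist u v)) \<partial>chain_measure) =
        (\<integral>\<^sup>+ p. slope f p \<partial>chain_measure)"
      by (simp add: slope_def split_def)
    then show "(SUP s. SUP t. ennreal \<bar>f s - f t\<bar>) \<le> 32 * majorizing_sup \<phi> m *
        (2 / 3 + 1 / 3 * (\<integral>\<^sup>+ (u, v). ennreal (\<phi> (\<bar>f u - f v\<bar> / dist u v)) \<partial>chain_measure))"
      using oscillation[OF f pos] by (auto intro!: SUP_least)
  qed (use prob_space_chain_measure[OF pos] sets_chain_measure in auto)
next
  case False
  \<comment> \<open>Any point mass serves here. With two distinct points the entropy supremum is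
    infinite and the bracket is nonzero, so the right side is infinite; on a one-point space the
    left side is 0.\<close>
  let ?\<nu> = "return borel (undefined :: 'a \<times> 'a)"
  show ?thesis
  proof (intro exI[of _ ?\<nu>] conjI allI impI)
    show "prob_space ?\<nu>" by (rule prob_space_return) simp
    fix f :: "'a \<Rightarrow> real"
    let ?I = "\<integral>\<^sup>+ (u, v). ennreal (\<phi> (\<bar>f u - f v\<bar> / dist u v)) \<partial>?\<nu>"
    show "(SUP s. SUP t. ennreal \<bar>f s - f t\<bar>) \<le> 32 * majorizing_sup \<phi> m * (2 / 3 + 1 / 3 * ?I)"
    proof (cases "\<exists>x y :: 'a. x \<noteq> y")
      case True
      with False have "majorizing_sup \<phi> m = \<top>" by (simp add: not_less top.extremum_unique)
      moreover have "2 / 3 + 1 / 3 * ?I \<noteq> 0"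
        by (simp add: ennreal_divide_eq_0_iff)
      ultimately show ?thesis by (simp add: ennreal_mult_top ennreal_top_mult)
    next
      case False
      then have "ennreal \<bar>f s - f t\<bar> = 0" for s t by (metis abs_zero diff_self ennreal_0)
      then show ?thesis by (simp only: SUP_const UNIV_not_empty not_False_eq_True zero_le)
    qed
  qed auto
qed

end
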